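(* Let $n\ge 4$ and let $G$ be a connected $n$-vertex graph with a $(3,2)$-cover that has the minimum possible number of edges among all connected $n$-vertex graphs with a $(3,2)$-cover. Then $G$ has a $(4,1)$-cover and $|E(G)|=F(n)$, where $F(n)$ denotes the minimum number of edges in a connected $n$-vertex graph with a $(4,1)$-cover.
   Context: A graph $G$ has a $(k,\ell)$-cover if every edge of $G$ lies in at least $\ell$ copies of $K_k$ (subgraphs isomorphic to the complete graph on $k$ vertices). Thus a $(3,2)$-cover means every edge lies in at least two triangles, and a $(4,1)$-cover means every edge lies in a copy of $K_4$. *)

theory Defs
  imports Main
begin

datatype 'a graph = Graph (verts: "'a set") (edges: "'a set set")

definition fin_simple_graph :: "'a graph \<Rightarrow> bool" where
  "fin_simple_graph G \<longleftrightarrow>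
     finite (verts G) \<and> (\<forall>e\<in>edges G. e \<subseteq> verts G \<and> card e = 2)"

definition graph_connected :: "'a graph \<Rightarrow> bool" where
  "graph_connected G \<longleftrightarrow>
     verts G \<noteq> {} \<and> (\<forall>u\<in>verts G. \<forall>v\<in>verts G. (u, v) \<in> {(x, y). {x, y} \<in> edges G}\<^sup>*)"

definition subgraph :: "'a graph \<Rightarrow> 'a graph \<Rightarrow> bool" where
  "subgraph H G \<longleftrightarrow> fin_simple_graph H \<and> verts H \<subseteq> verts G \<and> edges H \<subseteq> edges G"

definition graph_isomorphic :: "'a graph \<Rightarrow> 'b graph \<Rightarrow> bool" where
  "graph_isomorphic G H \<longleftrightarrow>
     (\<exists>f. bij_betw f (verts G) (verts H) \<and>
          (\<forall>u\<in>verts G. \<forall>v\<in>verts G. {u, v} \<in> edges G \<longleftrightarrow> {f u, f v} \<in> edges H))"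

definition complete_graph :: "nat \<Rightarrow> nat graph" where
  "complete_graph k = Graph {..<k} {e. e \<subseteq> {..<k} \<and> card e = 2}"

definition K_copies :: "nat \<Rightarrow> 'a graph \<Rightarrow> 'a graph set" where
  "K_copies k G = {H. subgraph H G \<and> graph_isomorphic H (complete_graph k)}"

text \<open>A finite graph has finitely many subgraphs, so the cardinality below is a genuine count.\<close>

definition has_cover :: "nat \<Rightarrow> nat \<Rightarrow> 'a graph \<Rightarrow> bool" where
  "has_cover k l G \<longleftrightarrow> (\<forall>e\<in>edges G. l \<le> card {H \<in> K_copies k G. e \<in> edges H})"

definition connected_cover_graph :: "nat \<Rightarrow> nat \<Rightarrow> nat \<Rightarrow> 'a graph \<Rightarrow> bool" where
  "connected_cover_graph k l n G \<longleftrightarrow>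
     fin_simple_graph G \<and> card (verts G) = n \<and> graph_connected G \<and> has_cover k l G"

text \<open>Every finite graph is isomorphic to one with vertices in \<^typ>\<open>nat\<close>, so this vertex type
  loses no generality. For \<open>n \<ge> 4\<close> the complete graph on \<open>n\<close> vertices qualifies, so the
  minimum is attained; for smaller \<open>n\<close> the value may be meaningless.\<close>

definition F :: "nat \<Rightarrow> nat" where
  "F n = (LEAST m. \<exists>G :: nat graph. connected_cover_graph 4 1 n G \<and> card (edges G) = m)"

end

(* Grow a vertex set S from a single vertex, in each step adding all neighbours of some u in S.
   A new vertex x has at least two neighbours in the neighbourhood of u besides u itself, so the
   sum of the degrees inside S grows by at least 4 per new vertex, with additional slack whenever
   x has further neighbours in S.  Hence a connected (3,2)-cover has at least 2(n-1) edges, and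
   with at most 2n-1 edges the total slack is at most 2, too little for an edge outside every K4.
   Gluing copies of K4 gives connected (4,1)-covers with at most 2n-1 edges for every n >= 4,
   so the minimum lies in this range. *)

theory Submission
  imports Defs
begin

section \<open>Counting edges while exploring a graph\<close>

text \<open>The graph is given by its neighbourhood function, so that all edge counts become
  cardinalities of sets \<open>N x \<inter> A\<close>. Connectedness takes the form in which
  exploration uses it: a nonempty set closed under neighbours is everything.\<close>

locale two_triangle_graph =
  fixes V :: "'a set" and N :: "'a \<Rightarrow> 'a set"
  assumes fin: "finite V"
    and N_subset: "N x \<subseteq> V"
    and N_irrefl: "x \<notin> N x"
    and N_sym: "y \<in> N x \<Longrightarrow> x \<in> N y"
    and triangles: "y \<in> N x \<Longrightarrow> 2 \<le> card (N x \<inter> N y)"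
    and conn: "S \<subseteq> V \<Longrightarrow> S \<noteq> {} \<Longrightarrow> (\<And>x. x \<in> S \<Longrightarrow> N x \<subseteq> S) \<Longrightarrow> S = V"
begin

text \<open>This is twice the number of edges induced by \<open>S\<close>; keeping the factor 2
  avoids any halving in the estimates.\<close>

definition inner_degrees :: "'a set \<Rightarrow> nat" where
  "inner_degrees S = (\<Sum>x\<in>S. card (N x \<inter> S))"

lemma finite_N: "finite (N x)"
  using N_subset fin finite_subset by blast

text \<open>Both sides count the adjacent pairs between \<open>A\<close> and \<open>B\<close>, once
  from each side.\<close>

lemma sum_card_swap:
  assumes "finite A" "finite B"
  shows "(\<Sum>x\<in>A. card (N x \<inter> B)) = (\<Sum>y\<in>B. card (N y \<inter> A))"
proof -
  have "(\<Sum>x\<in>A. card (N x \<inter> B)) = (\<Sum>x\<in>A. card {y \<in> B. y \<in> N x})"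
    by (rule sum.cong) (auto intro!: arg_cong[where f = card])
  also have "\<dots> = (\<Sum>y\<in>B. card {x \<in> A. y \<in> N x})"
    using assms by (intro sum_multicount_gen) auto
  also have "\<dots> = (\<Sum>y\<in>B. card (N y \<inter> A))"
    by (rule sum.cong) (auto intro!: arg_cong[where f = card] dest: N_sym)
  finally show ?thesis .
qed

text \<open>An edge from a new vertex \<open>x\<close> to \<open>S\<close> adds 2 to the degree sum,
  and an edge between two new vertices adds 1 at each end. So \<open>x\<close> is charged twice its
  edges to \<open>S\<close> plus its edges to new vertices. One copy of the edges to
  \<open>S\<close> is \<open>u\<close> together with \<open>N x \<inter> (S - {u})\<close>; all
  remaining charges cover \<open>u\<close> and every common neighbour of \<open>x\<close> and
  \<open>u\<close>.\<close>

lemma inner_degrees_step: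
  assumes S: "S \<subseteq> V" and u: "u \<in> S"
  shows "inner_degrees S
      + (\<Sum>x\<in>N u - S. 2 + card (N x \<inter> N u) + card (N x \<inter> (S - {u})))
    \<le> inner_degrees (S \<union> N u)"
proof -
  define C where "C = N u - S"
  have finS: "finite S" and finC: "finite C"
    using S fin finite_subset finite_N unfolding C_def by auto
  have disj: "S \<inter> C = {}" and un: "S \<union> N u = S \<union> C"
    by (auto simp: C_def)
  have split: "card (N x \<inter> (S \<union> C)) = card (N x \<inter> S) + card (N x \<inter> C)" for x
    using disj finite_N[of x]
    by (subst card_Un_disjoint[symmetric]) (auto intro!: arg_cong[where f = card])
  have "inner_degrees (S \<union> C) = inner_degrees S + (\<Sum>x\<in>S. card (N x \<inter> C))
      + (\<Sum>x\<in>C. card (N x \<inter> S) + card (N x \<inter> C))"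
    unfolding inner_degrees_def split
    by (subst sum.union_disjoint) (use finS finC disj in \<open>auto simp: sum.distrib\<close>)
  \<comment> \<open>The edges between \<open>S\<close> and \<open>C\<close> seen from
    \<open>S\<close> are recounted from \<open>C\<close>, so that the whole gain is a sum over new
    vertices.\<close>
  also have "\<dots> = inner_degrees S
      + (\<Sum>x\<in>C. card (N x \<inter> S) + (card (N x \<inter> S) + card (N x \<inter> C)))"
    by (subst sum_card_swap[OF finS finC]) (simp add: sum.distrib)
  finally have eq: "inner_degrees (S \<union> C) = \<dots>" .
  have "2 + card (N x \<inter> N u) + card (N x \<inter> (S - {u}))
      \<le> card (N x \<inter> S) + (card (N x \<inter> S) + card (N x \<inter> C))" if x: "x \<in> C" for x
  proof -
    have ux: "u \<in> N x" using x N_sym by (auto simp: C_def)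
    have "N x \<inter> S = insert u (N x \<inter> (S - {u}))" using ux u by auto
    then have 1: "card (N x \<inter> S) = Suc (card (N x \<inter> (S - {u})))"
      using finite_N[of x] by simp
    \<comment> \<open>\<open>N u\<close> lies inside \<open>S \<union> C\<close>, and
      \<open>u\<close> is a further neighbour of \<open>x\<close> there, outside
      \<open>N u\<close>.\<close>
    have "card (insert u (N x \<inter> N u)) \<le> card (N x \<inter> (S \<union> C))"
      using ux u finite_N[of x] by (intro card_mono) (auto simp: C_def)
    then have "Suc (card (N x \<inter> N u)) \<le> card (N x \<inter> S) + card (N x \<inter> C)"
      using N_irrefl finite_N[of x] by (simp add: split)
    with 1 show ?thesis by simp
  qed
  then show ?thesis
    unfolding un eq by (auto simp: C_def[symmetric] intro: sum_mono)
qed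

text \<open>Each new vertex has at least two common neighbours with \<open>u\<close>, which gives
  the 4. The remaining sum is the slack: adjacencies of new vertices to explored vertices other than
  \<open>u\<close>.\<close>

lemma inner_degrees_step_slack:
  assumes S: "S \<subseteq> V" and u: "u \<in> S"
  shows "inner_degrees S + 4 * card (N u - S) + (\<Sum>x\<in>N u - S. card (N x \<inter> (S - {u})))
    \<le> inner_degrees (S \<union> N u)"
proof -
  have "(\<Sum>x\<in>N u - S. 4 + card (N x \<inter> (S - {u})))
      \<le> (\<Sum>x\<in>N u - S. 2 + card (N x \<inter> N u) + card (N x \<inter> (S - {u})))"
    using triangles by (intro sum_mono) (fastforce simp: Int_commute)
  then show ?thesis
    using inner_degrees_step[OF assms] by (simp add: sum.distrib)
qed

lemma card_Un_N:
  assumes "S \<subseteq> V"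
  shows "card (S \<union> N u) = card S + card (N u - S)"
  using assms fin finite_subset finite_N
  by (metis Un_Diff_cancel Diff_disjoint card_Un_disjoint finite_Diff)

text \<open>The difference of \<open>inner_degrees S\<close> and \<open>4 * card S\<close> never
  decreases during exploration, and connectedness lets exploration run until \<open>S = V\<close>.
  Started at one vertex this gives \<open>4 * card V - 4\<close> as a lower bound for the degree
  sum.\<close>

lemma inner_degrees_extend:
  assumes "S \<subseteq> V" "S \<noteq> {}"
  shows "inner_degrees S + 4 * card V \<le> inner_degrees V + 4 * card S"
  using assms
proof (induction "card (V - S)" arbitrary: S rule: less_induct)
  case less
  show ?case
  proof (cases "S = V")
    case False
    then obtain u where u: "u \<in> S" "\<not> N u \<subseteq> S"
      using conn less.prems by blast
    have sub: "S \<union> N u \<subseteq> V" using less.prems N_subset by auto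
    have "V - (S \<union> N u) \<subset> V - S" using u sub by auto
    then have "card (V - (S \<union> N u)) < card (V - S)"
      using fin by (simp add: psubset_card_mono)
    from less.hyps[OF this sub] u
    have "inner_degrees (S \<union> N u) + 4 * card V \<le> inner_degrees V + 4 * card (S \<union> N u)"
      by auto
    then show ?thesis
      using inner_degrees_step_slack[OF less.prems(1) u(1)] card_Un_N[OF less.prems(1), of u]
      by simp
  qed simp
qed

text \<open>If \<open>uv\<close> lies in no \<open>K\<^sub>4\<close>, exploring \<open>u\<close>, then \<open>v\<close>, then a common neighbour \<open>w\<close> already
  produces a total slack of at least 3.\<close>

lemma edge_in_K4:
  assumes sparse: "inner_degrees V + 2 \<le> 4 * card V" and uv: "v \<in> N u"
  shows "\<exists>w z. w \<in> N u \<inter> N v \<and> z \<in> N u \<inter> N v \<and> z \<in> N w"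
proof (rule ccontr)
  assume "\<not> ?thesis"
  then have noK: "\<And>w z. w \<in> N u \<Longrightarrow> w \<in> N v \<Longrightarrow> z \<in> N u \<Longrightarrow> z \<in> N v \<Longrightarrow> z \<notin> N w"
    by blast
  have uV: "u \<in> V" using N_sym[OF uv] N_subset by auto
  \<comment> \<open>Of the two common neighbours guaranteed for an edge, at least one differs from
    any prescribed vertex \<open>t\<close>.\<close>
  have another: "\<exists>z. z \<in> N x \<and> z \<in> N y \<and> z \<noteq> t" if "y \<in> N x" for x y t
  proof (rule ccontr)
    assume "\<not> ?thesis"
    then have "N x \<inter> N y \<subseteq> {t}" by blast
    then have "card (N x \<inter> N y) \<le> 1" using card_mono[of "{t}"] by simp
    with triangles[OF that] show False by simp
  qed
  define S where "S = insert u (N u)"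
  define C where "C = N v - S"
  define T where "T = S \<union> N v"
  define L where "L = N u \<inter> N v"
  have SV: "S \<subseteq> V" and TV: "T \<subseteq> V" using uV N_subset by (auto simp: S_def T_def)
  have finS: "finite S" and finC: "finite C"
    using finite_N by (auto simp: S_def C_def)
  have L2: "2 \<le> card L" using triangles[OF uv] by (simp add: L_def)
  define slack where "slack = (\<Sum>x\<in>C. card (N x \<inter> (S - {v})))"
  \<comment> \<open>The exact numbers of common neighbours are kept here, because equality in this
    estimate later determines \<open>N w \<inter> N u\<close>.\<close>
  have step1: "(\<Sum>x\<in>N u. 2 + card (N x \<inter> N u)) \<le> inner_degrees S"
    using inner_degrees_step[of "{u}" u] uV N_irrefl[of u] by (simp add: S_def)
  have degS: "4 * card (N u) \<le> inner_degrees S"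
  proof -
    have "(\<Sum>x\<in>N u. 4) \<le> (\<Sum>x\<in>N u. 2 + card (N x \<inter> N u))"
      using triangles by (intro sum_mono) (fastforce simp: Int_commute)
    with step1 show ?thesis by simp
  qed
  have cardS: "card S = Suc (card (N u))" using finite_N N_irrefl by (simp add: S_def)
  have step2: "inner_degrees S + 4 * card C + slack \<le> inner_degrees T"
    using inner_degrees_step_slack[OF SV, of v] uv by (simp add: S_def C_def T_def slack_def)
  have cardT: "card T = card S + card C"
    using card_Un_N[OF SV, of v] by (simp add: T_def C_def)
  have endT: "inner_degrees T + 4 * card V \<le> inner_degrees V + 4 * card T"
    using inner_degrees_extend[OF TV] uV by (auto simp: T_def S_def)
  have slack_swap: "slack = (\<Sum>y\<in>S - {v}. card (N y \<inter> C))"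
    unfolding slack_def using finC finS by (intro sum_card_swap) auto
  \<comment> \<open>The edge \<open>yv\<close> has a common neighbour \<open>x\<close> other than
    \<open>u\<close>. If \<open>x\<close> were adjacent to \<open>u\<close>, then \<open>u\<close>,
    \<open>v\<close>, \<open>y\<close>, \<open>x\<close> would form a K4; hence \<open>x\<close> is
    new when \<open>v\<close> is explored. So the slack is at least \<open>card L\<close>.\<close>
  have L_slack: "1 \<le> card (N y \<inter> C)" if y: "y \<in> L" for y
  proof -
    from y obtain x where x: "x \<in> N v" "x \<in> N y" "x \<noteq> u"
      using another[of y v u] by (auto simp: L_def)
    then have "x \<in> N y \<inter> C" using noK[of y x] y by (auto simp: L_def C_def S_def)
    then show ?thesis using finC by (metis One_nat_def Suc_leI card_gt_0_iff empty_iff finite_Int)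
  qed
  have L_sub: "L \<subseteq> S - {v}" using N_irrefl by (auto simp: L_def S_def)
  have sum_L: "card L \<le> (\<Sum>y\<in>L. card (N y \<inter> C))"
    using sum_mono[of L "\<lambda>_. 1::nat" "\<lambda>y. card (N y \<inter> C)"] L_slack by simp
  have slack_split: "slack = (\<Sum>y\<in>L. card (N y \<inter> C)) + (\<Sum>y\<in>S - {v} - L. card (N y \<inter> C))"
    unfolding slack_swap using finS L_sub
    by (subst sum.subset_diff[of L]) auto
  \<comment> \<open>The hypothesis \<open>sparse\<close> allows a total slack of 2, and exploring
    \<open>v\<close> already uses \<open>card L \<ge> 2\<close>. Hence every estimate so far is an
    equality.\<close>
  have cardL: "card L = 2" and rest0: "(\<Sum>y\<in>S - {v} - L. card (N y \<inter> C)) = 0"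
    and tightS: "inner_degrees S = 4 * card (N u)"
    and tightT: "inner_degrees T + 2 = 4 * card T"
    using sparse L2 sum_L slack_split step2 cardT endT cardS degS by linarith+
  have rest: "N y \<inter> C = {}" if "y \<in> S" "y \<noteq> v" "y \<notin> L" for y
  proof -
    have "card (N y \<inter> C) = 0"
      using rest0 finS that by (simp add: sum_eq_0_iff)
    then show ?thesis using finC by simp
  qed
  obtain w w' where L: "L = {w, w'}" "w \<noteq> w'"
    using cardL by (auto simp: card_2_iff)
  have w: "w \<in> N u" "w \<in> N v" and ww': "w' \<notin> N w"
    using L noK[of w w'] by (auto simp: L_def)
  \<comment> \<open>A third common neighbour of \<open>w\<close> and \<open>u\<close> would make
    \<open>step1\<close> strict, against \<open>tightS\<close>.\<close>
  have two: "card (N w \<inter> N u) = 2"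
  proof (rule ccontr)
    assume "card (N w \<inter> N u) \<noteq> 2"
    then have "2 < card (N w \<inter> N u)" using triangles[OF w(1)] by (simp add: Int_commute)
    then have "(\<Sum>x\<in>N u. 4) < (\<Sum>x\<in>N u. 2 + card (N x \<inter> N u))"
      using w(1) triangles finite_N
      by (intro sum_strict_mono_ex1) (fastforce simp: Int_commute)+
    with step1 tightS show False by simp
  qed
  have vw: "v \<in> N w \<inter> N u" using w uv N_sym by auto
  have "card (N w \<inter> N u - {v}) = 1"
    using two vw finite_N by (subst card_Diff_subset) auto
  then obtain q where "N w \<inter> N u - {v} = {q}" by (auto simp: card_1_singleton_iff)
  then have q: "N w \<inter> N u = {v, q}" "q \<noteq> v" using vw by auto
  have qw: "q \<in> N w" and qu: "q \<in> N u" using q by auto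
  \<comment> \<open>\<open>L\<close> consists of \<open>w\<close> and \<open>w'\<close>, and neither
    is adjacent to \<open>w\<close>. So \<open>q\<close> is adjacent to \<open>u\<close> but not to
    \<open>v\<close>.\<close>
  have qL: "q \<notin> L" using L qw ww' N_irrefl by auto
  \<comment> \<open>The edge \<open>qw\<close> has \<open>u\<close> as one common neighbour;
    \<open>y\<close> is another. It turns out to be still unexplored after \<open>u\<close> and
    \<open>v\<close>, and adjacent to two explored vertices.\<close>
  obtain y where y: "y \<in> N w" "y \<in> N q" "y \<noteq> u"
    using another[OF qw] by blast
  have yu: "y \<notin> N u"
  proof
    assume "y \<in> N u"
    then have "y = v \<or> y = q" using q(1) y(1) by blast
    then have "v \<in> N q" using y(2) N_irrefl by auto
    then show False using N_sym qL qu by (auto simp: L_def)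
  qed
  have yS: "y \<notin> S" using y yu by (simp add: S_def)
  have qS: "q \<in> S" using qu by (simp add: S_def)
  \<comment> \<open>Otherwise \<open>y\<close> would lie in \<open>C\<close> and be adjacent to
    \<open>q\<close>, but by \<open>rest\<close> only \<open>v\<close> and the members of
    \<open>L\<close> have neighbours in \<open>C\<close>.\<close>
  have "y \<notin> N v" using rest[OF qS q(2) qL] y yS by (auto simp: C_def)
  then have yT: "y \<in> N w - T" using y yS by (simp add: T_def)
  have wT: "w \<in> T" using w by (simp add: T_def S_def)
  \<comment> \<open>Exploring \<open>w\<close> adds \<open>y\<close>, whose adjacency to
    \<open>q\<close> is a third unit of slack, exceeding the allowance.\<close>
  have "q \<in> N y \<inter> (T - {w})"
    using y N_sym qS qw N_irrefl by (auto simp: T_def)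
  then have "1 \<le> card (N y \<inter> (T - {w}))"
    by (metis One_nat_def Suc_leI card_gt_0_iff empty_iff finite_Int finite_N)
  also have "\<dots> \<le> (\<Sum>x\<in>N w - T. card (N x \<inter> (T - {w})))"
    using yT finite_N by (intro member_le_sum) auto
  finally have "inner_degrees T + 4 * card (N w - T) + 1 \<le> inner_degrees (T \<union> N w)"
    using inner_degrees_step_slack[OF TV wT] by linarith
  moreover have "card (T \<union> N w) = card T + card (N w - T)" by (rule card_Un_N[OF TV])
  moreover have "inner_degrees (T \<union> N w) + 4 * card V \<le> inner_degrees V + 4 * card (T \<union> N w)"
    using inner_degrees_extend[of "T \<union> N w"] TV N_subset wT by auto
  ultimately show False using tightT sparse by linarith
qed

end

section \<open>Covers in terms of cliques\<close>

definition pairs :: "'a set \<Rightarrow> 'a set set" where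
  "pairs K = {e. e \<subseteq> K \<and> card e = 2}"

text \<open>Cliques are vertex sets, so that counting copies of a complete graph reduces to counting
  sets.\<close>

definition cliques :: "nat \<Rightarrow> 'a graph \<Rightarrow> 'a set set" where
  "cliques k G = {K. K \<subseteq> verts G \<and> finite K \<and> card K = k \<and> pairs K \<subseteq> edges G}"

definition nbrs :: "'a graph \<Rightarrow> 'a \<Rightarrow> 'a set" where
  "nbrs G x = {y. {x, y} \<in> edges G}"

lemma fin_simple_graphD:
  assumes "fin_simple_graph G"
  shows "finite (verts G)" "e \<in> edges G \<Longrightarrow> e \<subseteq> verts G" "e \<in> edges G \<Longrightarrow> card e = 2"
    "finite (edges G)" "{x, y} \<in> edges G \<Longrightarrow> x \<noteq> y"
proof -
  show 1: "finite (verts G)" and 2: "\<And>e. e \<in> edges G \<Longrightarrow> e \<subseteq> verts G"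
    and 3: "\<And>e. e \<in> edges G \<Longrightarrow> card e = 2"
    using assms by (auto simp: fin_simple_graph_def)
  have "edges G \<subseteq> Pow (verts G)" using 2 by auto
  then show "finite (edges G)" using 1 finite_subset by auto
  show "x \<noteq> y" if "{x, y} \<in> edges G" using 3[OF that] by auto
qed

lemma ball_edges:
  assumes "fin_simple_graph G"
  shows "(\<forall>e\<in>edges G. P e) \<longleftrightarrow> (\<forall>x y. {x, y} \<in> edges G \<longrightarrow> P {x, y})"
proof (intro iffI ballI)
  fix e assume P: "\<forall>x y. {x, y} \<in> edges G \<longrightarrow> P {x, y}" and e: "e \<in> edges G"
  from fin_simple_graphD(3)[OF assms e] obtain x y where "e = {x, y}" by (auto simp: card_2_iff)
  with P e show "P e" by blast
qed blast

text \<open>An isomorphism with a complete graph forces all pairs of vertices to be edges, so a copy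
  is determined by its vertex set; conversely, any bijection from a \<open>k\<close>-clique to
  \<open>{..<k}\<close> is an isomorphism.\<close>

lemma K_copies_eq: "K_copies k G = (\<lambda>K. Graph K (pairs K)) ` cliques k G"
proof (intro equalityI subsetI)
  fix H assume "H \<in> K_copies k G"
  then have sub: "subgraph H G" and iso: "graph_isomorphic H (complete_graph k)"
    by (auto simp: K_copies_def)
  from sub have simple: "fin_simple_graph H" by (simp add: subgraph_def)
  from iso obtain f where f: "bij_betw f (verts H) {..<k}"
    and fe: "\<And>u v. u \<in> verts H \<Longrightarrow> v \<in> verts H \<Longrightarrow>
      {u, v} \<in> edges H \<longleftrightarrow> {f u, f v} \<in> edges (complete_graph k)"
    by (auto simp: graph_isomorphic_def complete_graph_def)
  have "edges H = pairs (verts H)"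
  proof (intro equalityI subsetI)
    fix e assume "e \<in> edges H"
    then show "e \<in> pairs (verts H)" using simple by (auto simp: fin_simple_graph_def pairs_def)
  next
    fix e assume "e \<in> pairs (verts H)"
    then obtain u v where e: "e = {u, v}" "u \<noteq> v" "u \<in> verts H" "v \<in> verts H"
      by (auto simp: pairs_def card_2_iff)
    then have "f u \<noteq> f v" "f u < k" "f v < k"
      using f by (auto simp: bij_betw_def inj_on_def)
    then show "e \<in> edges H" using fe[of u v] e by (auto simp: complete_graph_def)
  qed
  moreover have "card (verts H) = k" using bij_betw_same_card[OF f] by simp
  ultimately have "verts H \<in> cliques k G" "H = Graph (verts H) (pairs (verts H))"
    using sub simple by (auto simp: cliques_def subgraph_def fin_simple_graph_def graph.expand)
  then show "H \<in> (\<lambda>K. Graph K (pairs K)) ` cliques k G" by blast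
next
  fix H assume "H \<in> (\<lambda>K. Graph K (pairs K)) ` cliques k G"
  then obtain K where H: "H = Graph K (pairs K)" and K: "K \<in> cliques k G" by blast
  from K have finK: "finite K" and cardK: "card K = k" by (auto simp: cliques_def)
  obtain f where f: "bij_betw f K {..<k}"
    using finK cardK by (metis finite_lessThan card_lessThan finite_same_card_bij)
  have "{u, v} \<in> pairs K \<longleftrightarrow> {f u, f v} \<in> edges (complete_graph k)"
    if "u \<in> K" "v \<in> K" for u v
  proof -
    have "f u < k" "f v < k" "f u = f v \<longleftrightarrow> u = v"
      using f that by (auto simp: bij_betw_def inj_on_def)
    then show ?thesis using that by (cases "u = v") (auto simp: pairs_def complete_graph_def)
  qed
  then have "graph_isomorphic H (complete_graph k)"
    using f by (auto simp: graph_isomorphic_def H complete_graph_def)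
  moreover have "subgraph H G"
    using K by (auto simp: subgraph_def H cliques_def fin_simple_graph_def pairs_def)
  ultimately show "H \<in> K_copies k G" by (simp add: K_copies_def)
qed

lemma has_cover_iff:
  assumes "fin_simple_graph G"
  shows "has_cover k l G \<longleftrightarrow> (\<forall>e\<in>edges G. l \<le> card {K \<in> cliques k G. e \<subseteq> K})"
proof -
  have "card {H \<in> K_copies k G. e \<in> edges H} = card {K \<in> cliques k G. e \<subseteq> K}"
    if e: "e \<in> edges G" for e
  proof -
    have "e \<in> pairs K \<longleftrightarrow> e \<subseteq> K" for K
      using fin_simple_graphD(3)[OF assms e] by (simp add: pairs_def)
    then have "{H \<in> K_copies k G. e \<in> edges H}
        = (\<lambda>K. Graph K (pairs K)) ` {K \<in> cliques k G. e \<subseteq> K}"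
      unfolding K_copies_eq by auto
    then show ?thesis by (simp add: card_image inj_on_def)
  qed
  then show ?thesis unfolding has_cover_def by simp
qed

lemma finite_cliques: "fin_simple_graph G \<Longrightarrow> finite (cliques k G)"
  by (rule finite_subset[of _ "Pow (verts G)"]) (auto simp: cliques_def fin_simple_graph_def)

text \<open>Together with \<open>pairs_empty\<close> this lets simplification list the edges of a
  complete graph on explicitly given vertices.\<close>

lemma pairs_insert: "pairs (insert x A) = pairs A \<union> (\<lambda>y. {x, y}) ` (A - {x})"
proof (intro equalityI subsetI)
  fix e assume "e \<in> pairs (insert x A)"
  then obtain a b where "e = {a, b}" "a \<noteq> b" "a \<in> insert x A" "b \<in> insert x A"
    by (auto simp: pairs_def card_2_iff)
  then show "e \<in> pairs A \<union> (\<lambda>y. {x, y}) ` (A - {x})"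
    by (cases "a = x"; cases "b = x") (auto simp: pairs_def)
qed (auto simp: pairs_def)

lemma pairs_empty: "pairs {} = {}"
  by (auto simp: pairs_def)

text \<open>Sending a triangle through \<open>xy\<close> to its third vertex is a bijection onto the
  common neighbours of \<open>x\<close> and \<open>y\<close>.\<close>

lemma has_cover_3_iff:
  assumes "fin_simple_graph G"
  shows "has_cover 3 l G \<longleftrightarrow> (\<forall>x y. {x, y} \<in> edges G \<longrightarrow> l \<le> card (nbrs G x \<inter> nbrs G y))"
proof -
  note G = fin_simple_graphD[OF assms]
  have "card {K \<in> cliques 3 G. {x, y} \<subseteq> K} = card (nbrs G x \<inter> nbrs G y)"
    if xy: "{x, y} \<in> edges G" for x y
  proof -
    have "{K \<in> cliques 3 G. {x, y} \<subseteq> K} = (\<lambda>z. {x, y, z}) ` (nbrs G x \<inter> nbrs G y)"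
    proof (intro equalityI subsetI)
      fix K assume "K \<in> {K \<in> cliques 3 G. {x, y} \<subseteq> K}"
      then have K: "card K = 3" "pairs K \<subseteq> edges G" "x \<in> K" "y \<in> K" by (auto simp: cliques_def)
      then have "card (K - {x, y}) = 1"
        using G(5)[OF xy] by (subst card_Diff_subset) auto
      then obtain z where "K - {x, y} = {z}" by (auto simp: card_1_singleton_iff)
      then have z: "K = {x, y, z}" "z \<noteq> x" "z \<noteq> y" using K by auto
      then have "{x, z} \<in> edges G" "{y, z} \<in> edges G"
        using K by (auto simp: pairs_def)
      with z show "K \<in> (\<lambda>z. {x, y, z}) ` (nbrs G x \<inter> nbrs G y)" by (auto simp: nbrs_def)
    next
      fix K assume "K \<in> (\<lambda>z. {x, y, z}) ` (nbrs G x \<inter> nbrs G y)"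
      then obtain z where z: "K = {x, y, z}" "{x, z} \<in> edges G" "{y, z} \<in> edges G"
        by (auto simp: nbrs_def)
      have "pairs K \<subseteq> edges G" using z xy
        by (auto simp: pairs_insert pairs_empty insert_commute)
      moreover have "card K = 3" using z G(5)[OF xy] G(5)[OF z(2)] G(5)[OF z(3)] by simp
      moreover have "K \<subseteq> verts G" using z xy G(2) by blast
      ultimately show "K \<in> {K \<in> cliques 3 G. {x, y} \<subseteq> K}" using z by (simp add: cliques_def)
    qed
    moreover have "inj_on (\<lambda>z. {x, y, z}) (nbrs G x \<inter> nbrs G y)"
    proof (rule inj_onI)
      fix a b assume a: "a \<in> nbrs G x \<inter> nbrs G y" and ab: "{x, y, a} = {x, y, b}"
      have "a \<noteq> x" "a \<noteq> y" using a G(5)[of x a] G(5)[of y a] by (auto simp: nbrs_def)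
      then show "a = b" using ab by blast
    qed
    ultimately show ?thesis by (simp add: card_image)
  qed
  then show ?thesis unfolding has_cover_iff[OF assms] ball_edges[OF assms] by simp
qed

text \<open>The two vertices of a K4 besides \<open>x\<close> and \<open>y\<close> are adjacent
  common neighbours. For a single copy existence suffices, so no bijection is required.\<close>

lemma has_cover_4_1_iff:
  assumes "fin_simple_graph G"
  shows "has_cover 4 1 G \<longleftrightarrow> (\<forall>x y. {x, y} \<in> edges G \<longrightarrow>
    (\<exists>w z. w \<in> nbrs G x \<inter> nbrs G y \<and> z \<in> nbrs G x \<inter> nbrs G y \<and> z \<in> nbrs G w))"
proof -
  note G = fin_simple_graphD[OF assms]
  have "1 \<le> card {K \<in> cliques 4 G. {x, y} \<subseteq> K} \<longleftrightarrow>
      (\<exists>w z. w \<in> nbrs G x \<inter> nbrs G y \<and> z \<in> nbrs G x \<inter> nbrs G y \<and> z \<in> nbrs G w)"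
    if xy: "{x, y} \<in> edges G" for x y
  proof -
    have "1 \<le> card {K \<in> cliques 4 G. {x, y} \<subseteq> K} \<longleftrightarrow> (\<exists>K \<in> cliques 4 G. {x, y} \<subseteq> K)"
      using finite_cliques[OF assms, of 4] card_gt_0_iff[of "{K \<in> cliques 4 G. {x, y} \<subseteq> K}"]
      by (auto simp: Suc_le_eq)
    also have "\<dots> \<longleftrightarrow>
      (\<exists>w z. w \<in> nbrs G x \<inter> nbrs G y \<and> z \<in> nbrs G x \<inter> nbrs G y \<and> z \<in> nbrs G w)"
    proof
      assume "\<exists>K \<in> cliques 4 G. {x, y} \<subseteq> K"
      then obtain K where K: "card K = 4" "pairs K \<subseteq> edges G" "x \<in> K" "y \<in> K"
        by (auto simp: cliques_def)
      then have "card (K - {x, y}) = 2"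
        using G(5)[OF xy] by (subst card_Diff_subset) auto
      then obtain w z where "K - {x, y} = {w, z}" "w \<noteq> z" by (auto simp: card_2_iff)
      then have "w \<in> K" "z \<in> K" "w \<noteq> z" "w \<noteq> x" "w \<noteq> y" "z \<noteq> x" "z \<noteq> y" by auto
      then have "{x, w} \<in> pairs K" "{x, z} \<in> pairs K" "{y, w} \<in> pairs K" "{y, z} \<in> pairs K"
        "{w, z} \<in> pairs K"
        using K by (auto simp: pairs_def)
      with K show "\<exists>w z. w \<in> nbrs G x \<inter> nbrs G y \<and> z \<in> nbrs G x \<inter> nbrs G y \<and> z \<in> nbrs G w"
        by (auto simp: nbrs_def)
    next
      assume "\<exists>w z. w \<in> nbrs G x \<inter> nbrs G y \<and> z \<in> nbrs G x \<inter> nbrs G y \<and> z \<in> nbrs G w"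
      then obtain w z where wz: "{x, w} \<in> edges G" "{y, w} \<in> edges G" "{x, z} \<in> edges G"
        "{y, z} \<in> edges G" "{w, z} \<in> edges G" by (auto simp: nbrs_def)
      have "pairs {x, y, w, z} \<subseteq> edges G"
        using wz xy by (auto simp: pairs_insert pairs_empty)
      moreover have "card {x, y, w, z} = 4"
        using G(5)[OF xy] wz[THEN G(5)] by simp
      moreover have "{x, y, w, z} \<subseteq> verts G" using wz xy G(2) by blast
      ultimately have "{x, y, w, z} \<in> cliques 4 G" by (simp add: cliques_def)
      then show "\<exists>K \<in> cliques 4 G. {x, y} \<subseteq> K" by blast
    qed
    finally show ?thesis .
  qed
  then show ?thesis unfolding has_cover_iff[OF assms] ball_edges[OF assms] by simp
qed

text \<open>The other two vertices of a K4 through an edge are distinct, and each completes the edge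
  to a triangle.\<close>

lemma has_cover_4_1_imp_3_2:
  assumes G: "fin_simple_graph G" and "has_cover 4 1 G"
  shows "has_cover 3 2 G"
  unfolding has_cover_3_iff[OF G]
proof (intro allI impI)
  fix x y assume "{x, y} \<in> edges G"
  then obtain w z where wz: "w \<in> nbrs G x \<inter> nbrs G y" "z \<in> nbrs G x \<inter> nbrs G y" "z \<in> nbrs G w"
    using assms(2) unfolding has_cover_4_1_iff[OF G] by blast
  have "finite (nbrs G x)"
    by (rule finite_subset[of _ "verts G"])
      (use fin_simple_graphD[OF G] in \<open>auto simp: nbrs_def\<close>)
  then have "card {w, z} \<le> card (nbrs G x \<inter> nbrs G y)"
    using wz by (intro card_mono) auto
  then show "2 \<le> card (nbrs G x \<inter> nbrs G y)"
    using wz(3) fin_simple_graphD(5)[OF G] by (auto simp: nbrs_def)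
qed

section \<open>From edge counts to the exploration bound\<close>

lemma handshake:
  assumes "fin_simple_graph G"
  shows "(\<Sum>x\<in>verts G. card (nbrs G x)) = 2 * card (edges G)"
proof -
  note G = fin_simple_graphD[OF assms]
  have "(\<Sum>x\<in>verts G. card (nbrs G x)) = (\<Sum>x\<in>verts G. card {e \<in> edges G. x \<in> e})"
  proof (rule sum.cong)
    fix x assume "x \<in> verts G"
    have "{e \<in> edges G. x \<in> e} = (\<lambda>y. {x, y}) ` nbrs G x"
    proof (intro equalityI subsetI)
      fix e assume e: "e \<in> {e \<in> edges G. x \<in> e}"
      then obtain a b where "e = {a, b}" using G(3)[of e] by (auto simp: card_2_iff)
      with e show "e \<in> (\<lambda>y. {x, y}) ` nbrs G x"
        by (auto simp: nbrs_def insert_commute)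
    qed (auto simp: nbrs_def)
    moreover have "inj_on (\<lambda>y. {x, y}) (nbrs G x)"
      by (auto simp: inj_on_def doubleton_eq_iff)
    ultimately show "card (nbrs G x) = card {e \<in> edges G. x \<in> e}"
      by (simp add: card_image)
  qed simp
  also have "\<dots> = (\<Sum>e\<in>edges G. card {x \<in> verts G. x \<in> e})"
    using G by (intro sum_multicount_gen) auto
  also have "\<dots> = (\<Sum>e\<in>edges G. 2)"
  proof (rule sum.cong)
    fix e assume e: "e \<in> edges G"
    then have "{x \<in> verts G. x \<in> e} = e" using G(2) by auto
    then show "card {x \<in> verts G. x \<in> e} = 2" using G(3)[OF e] by simp
  qed simp
  finally show ?thesis by simp
qed

lemma connected_closed_set:
  assumes "graph_connected G" "S \<subseteq> verts G" "S \<noteq> {}" "\<And>x. x \<in> S \<Longrightarrow> nbrs G x \<subseteq> S"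
  shows "S = verts G"
proof -
  obtain r where r: "r \<in> S" using assms by auto
  have "v \<in> S" if v: "v \<in> verts G" for v
  proof -
    have "(r, v) \<in> {(x, y). {x, y} \<in> edges G}\<^sup>*"
      using assms r v by (auto simp: graph_connected_def)
    then show ?thesis
      by (induction rule: rtrancl_induct) (use r assms(4) in \<open>auto simp: nbrs_def\<close>)
  qed
  then show ?thesis using assms(2) by auto
qed

text \<open>By the handshake identity, at most \<open>2 * n - 1\<close> edges means a degree sum of
  at most \<open>4 * n - 2\<close>, which is the sparsity required for every edge to lie in a
  K4.\<close>

lemma sparse_3_2_cover_imp_4_1_cover:
  assumes cover: "connected_cover_graph 3 2 n G" and sparse: "card (edges G) + 1 \<le> 2 * n"
  shows "has_cover 4 1 G"
proof -
  have G: "fin_simple_graph G" and card: "card (verts G) = n" and con: "graph_connected G"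
    and cov: "has_cover 3 2 G"
    using cover by (auto simp: connected_cover_graph_def)
  interpret two_triangle_graph "verts G" "nbrs G"
  proof
    show "2 \<le> card (nbrs G x \<inter> nbrs G y)" if "y \<in> nbrs G x" for x y
      using cov that has_cover_3_iff[OF G] by (auto simp: nbrs_def)
    show "x \<notin> nbrs G x" for x
      using fin_simple_graphD(3)[OF G, of "{x}"] by (auto simp: nbrs_def)
    show "S = verts G" if "S \<subseteq> verts G" "S \<noteq> {}" "\<And>x. x \<in> S \<Longrightarrow> nbrs G x \<subseteq> S" for S
      by (rule connected_closed_set[OF con that])
  qed (use fin_simple_graphD[OF G] in \<open>auto simp: nbrs_def insert_commute\<close>)
  have "inner_degrees (verts G) = (\<Sum>x\<in>verts G. card (nbrs G x))"
    unfolding inner_degrees_def by (intro sum.cong arg_cong[where f = card] refl) (use N_subset in blast)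
  then have "inner_degrees (verts G) + 2 \<le> 4 * card (verts G)"
    using handshake[OF G] sparse card by simp
  then show ?thesis
    unfolding has_cover_4_1_iff[OF G] using edge_in_K4 by (auto simp: nbrs_def)
qed

section \<open>Relabelling vertices\<close>

text \<open>This transports covers between the vertex type of \<open>G\<close> and the natural
  numbers used in \<open>F\<close>. As covers are lower bounds on clique counts, an injection of
  cliques is enough.\<close>

lemma connected_cover_graph_image:
  assumes cover: "connected_cover_graph k l n G" and f: "inj_on f (verts G)"
  defines "H \<equiv> Graph (f ` verts G) ((`) f ` edges G)"
  shows "connected_cover_graph k l n H" "card (edges H) = card (edges G)"
proof -
  have G: "fin_simple_graph G" and con: "graph_connected G" and cov: "has_cover k l G"
    using cover by (auto simp: connected_cover_graph_def)
  note G' = fin_simple_graphD[OF G]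
  have inj: "inj_on f A" if "A \<subseteq> verts G" for A using f that inj_on_subset by blast
  have injI: "inj_on ((`) f) A" if "A \<subseteq> Pow (verts G)" for A
    using inj_on_image_Pow[OF f] that inj_on_subset by blast
  have simple: "fin_simple_graph H"
    using G' inj by (auto simp: fin_simple_graph_def H_def card_image)
  have conH: "graph_connected H"
  proof -
    have "(f u, f v) \<in> {(x, y). {x, y} \<in> edges H}\<^sup>*"
      if "(u, v) \<in> {(x, y). {x, y} \<in> edges G}\<^sup>*" for u v
      using that
    proof (induction rule: rtrancl_induct)
      case (step y z)
      then have "f ` {y, z} \<in> edges H" by (auto simp: H_def simp del: image_insert)
      with step show ?case by (auto intro: rtrancl_into_rtrancl)
    qed simp
    then show ?thesis using con by (auto simp: graph_connected_def H_def)
  qed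
  have "l \<le> card {K \<in> cliques k H. f ` e \<subseteq> K}" if e: "e \<in> edges G" for e
  proof -
    have "(`) f ` {K \<in> cliques k G. e \<subseteq> K} \<subseteq> {K \<in> cliques k H. f ` e \<subseteq> K}"
    proof (safe)
      fix K assume K: "K \<in> cliques k G" "e \<subseteq> K"
      have "pairs (f ` K) \<subseteq> edges H"
      proof
        fix d assume "d \<in> pairs (f ` K)"
        then obtain p q where "d = {p, q}" "p \<noteq> q" "p \<in> f ` K" "q \<in> f ` K"
          by (auto simp: pairs_def card_2_iff)
        then obtain a b where ab: "d = f ` {a, b}" "a \<in> K" "b \<in> K" "a \<noteq> b"
          by auto
        then have "{a, b} \<in> pairs K" by (simp add: pairs_def)
        then show "d \<in> edges H" using ab(1) K by (auto simp: H_def cliques_def simp del: image_insert)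
      qed
      then show "f ` K \<in> cliques k H" using K inj by (auto simp: cliques_def H_def card_image)
    qed auto
    moreover have "inj_on ((`) f) {K \<in> cliques k G. e \<subseteq> K}"
      by (rule injI) (auto simp: cliques_def)
    ultimately have "card {K \<in> cliques k G. e \<subseteq> K} \<le> card {K \<in> cliques k H. f ` e \<subseteq> K}"
      using finite_cliques[OF simple, of k] card_inj_on_le by fastforce
    moreover have "l \<le> card {K \<in> cliques k G. e \<subseteq> K}"
      using cov e unfolding has_cover_iff[OF G] by blast
    ultimately show ?thesis by simp
  qed
  then have "has_cover k l H"
    unfolding has_cover_iff[OF simple] by (auto simp: H_def)
  then show "connected_cover_graph k l n H"
    using cover simple conH card_image[OF f] by (simp add: connected_cover_graph_def H_def)
  show "card (edges H) = card (edges G)"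
    unfolding H_def graph.sel by (intro card_image injI) (use G'(2) in blast)
qed

section \<open>Sparse covers by copies of \<open>K\<^sub>4\<close>\<close>

text \<open>Adjacency is symmetric, so reachability from one root \<open>r\<close> connects any two
  vertices through \<open>r\<close>.\<close>

lemma connected_coverI:
  assumes "fin_simple_graph G" "card (verts G) = n" "r \<in> verts G"
    and "\<And>v. v \<in> verts G \<Longrightarrow> (r, v) \<in> {(x, y). {x, y} \<in> edges G}\<^sup>*"
    and "\<And>e. e \<in> edges G \<Longrightarrow> \<exists>K \<in> cliques 4 G. e \<subseteq> K"
  shows "connected_cover_graph 4 1 n G"
proof -
  have "sym {(x, y). {x, y} \<in> edges G}" by (auto simp: sym_def insert_commute)
  then have "(u, v) \<in> {(x, y). {x, y} \<in> edges G}\<^sup>*" if "u \<in> verts G" "v \<in> verts G" for u v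
    using assms(4)[OF that(1)] assms(4)[OF that(2)] by (meson rtrancl_trans sym_rtrancl symD)
  then have "graph_connected G" using assms(3) by (auto simp: graph_connected_def)
  moreover have "1 \<le> card {K \<in> cliques 4 G. e \<subseteq> K}" if "e \<in> edges G" for e
    using assms(5)[OF that] finite_cliques[OF assms(1), of 4]
      card_gt_0_iff[of "{K \<in> cliques 4 G. e \<subseteq> K}"] by (auto simp: Suc_le_eq)
  ultimately show ?thesis
    using assms by (simp add: connected_cover_graph_def has_cover_iff)
qed

text \<open>Old cliques survive, new edges lie in \<open>K\<close>, and the shared vertex
  \<open>r\<close> is adjacent to all other vertices of \<open>K\<close>. The overlap of
  \<open>K\<close> with \<open>V\<close> may be larger than \<open>r\<close>, which allows one, two
  or three new vertices.\<close>

lemma connected_cover_glue: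
  assumes cover: "connected_cover_graph 4 1 n (Graph V E)"
    and K: "finite K" "card K = 4" "r \<in> K" "r \<in> V" and m: "card (V \<union> K) = m"
  shows "connected_cover_graph 4 1 m (Graph (V \<union> K) (E \<union> pairs K))"
proof -
  let ?G = "Graph (V \<union> K) (E \<union> pairs K)"
  have G: "fin_simple_graph (Graph V E)" and con: "graph_connected (Graph V E)"
    and cov: "has_cover 4 1 (Graph V E)"
    using cover by (auto simp: connected_cover_graph_def)
  show ?thesis
  proof (rule connected_coverI)
    show "fin_simple_graph ?G"
      using G K by (auto simp: fin_simple_graph_def pairs_def)
    show "card (verts ?G) = m" "r \<in> verts ?G" using K m by auto
  next
    fix v assume v: "v \<in> verts ?G"
    show "(r, v) \<in> {(x, y). {x, y} \<in> edges ?G}\<^sup>*"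
    proof (cases "v \<in> V")
      case True
      then have "(r, v) \<in> {(x, y). {x, y} \<in> E}\<^sup>*"
        using con K by (auto simp: graph_connected_def)
      then show ?thesis by (rule rtrancl_mono[THEN subsetD, rotated]) auto
    next
      case False
      then have "r \<noteq> v" using K by auto
      then have "{r, v} \<in> pairs K" using False v K by (auto simp: pairs_def)
      then show ?thesis by auto
    qed
  next
    fix e assume "e \<in> edges ?G"
    then consider "e \<in> E" | "e \<in> pairs K" by auto
    then show "\<exists>L \<in> cliques 4 ?G. e \<subseteq> L"
    proof cases
      case 1
      then have "1 \<le> card {L \<in> cliques 4 (Graph V E). e \<subseteq> L}"
        using cov unfolding has_cover_iff[OF G] by simp
      then obtain L where "L \<in> cliques 4 (Graph V E)" "e \<subseteq> L"
        by (metis (mono_tags, lifting) card.empty empty_Collect_eq not_one_le_zero)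
      then have "L \<in> cliques 4 ?G" by (auto simp: cliques_def)
      with \<open>e \<subseteq> L\<close> show ?thesis by blast
    next
      case 2
      then have "e \<subseteq> K" by (simp add: pairs_def)
      moreover have "K \<in> cliques 4 ?G" using K by (simp add: cliques_def)
      ultimately show ?thesis by blast
    qed
  qed
qed

text \<open>Gluing a K4 at one vertex adds 3 vertices and 6 edges, preserving the bound
  \<open>2 * n - 1\<close>. The base cases 4, 5 and 6 represent all residues modulo 3, with 6, 9 and
  11 edges.\<close>

lemma sparse_4_1_cover_exists:
  "4 \<le> n \<Longrightarrow> \<exists>E. connected_cover_graph 4 1 n (Graph {..<n} E) \<and> card E + 1 \<le> 2 * n"
proof (induction n rule: less_induct)
  case (less n)
  define E4 where "E4 = pairs {0, 1, 2, 3 :: nat}"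
  \<comment> \<open>A single vertex is covered vacuously, and gluing onto it produces K4
    itself.\<close>
  have point: "connected_cover_graph 4 1 1 (Graph {0 :: nat} {})"
    by (rule connected_coverI[where r = 0]) (auto simp: fin_simple_graph_def)
  have "{0} \<union> {0, 1, 2, 3} = {..<4 :: nat}" by auto
  then have K4: "connected_cover_graph 4 1 4 (Graph {..<4} E4)"
    using connected_cover_glue[OF point, of "{0, 1, 2, 3}" 0 4] by (simp add: E4_def)
  have cardE4: "card E4 = 6"
    by (simp add: E4_def pairs_insert pairs_empty doubleton_eq_iff)
  consider "n = 4" | "n = 5" | "n = 6" | "7 \<le> n" using less.prems by linarith
  then show ?case
  proof cases
    case 1
    with K4 cardE4 show ?thesis by auto
  next
    case 2
    \<comment> \<open>The two copies of K4 share the triangle on 0, 1, 2.\<close>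
    have V: "{..<4} \<union> {0, 1, 2, 4} = {..<5 :: nat}" by auto
    have "connected_cover_graph 4 1 5 (Graph {..<5} (E4 \<union> pairs {0, 1, 2, 4}))"
      using connected_cover_glue[OF K4, of "{0, 1, 2, 4}" 0 5] unfolding V by simp
    moreover have "card (E4 \<union> pairs {0, 1, 2, 4}) + 1 \<le> 2 * 5"
      by (simp add: E4_def pairs_insert pairs_empty doubleton_eq_iff card_insert_if)
    ultimately show ?thesis using 2 by blast
  next
    case 3
    \<comment> \<open>The two copies of K4 share the edge joining 0 and 1.\<close>
    have V: "{..<4} \<union> {0, 1, 4, 5} = {..<6 :: nat}" by auto
    have "connected_cover_graph 4 1 6 (Graph {..<6} (E4 \<union> pairs {0, 1, 4, 5}))"
      using connected_cover_glue[OF K4, of "{0, 1, 4, 5}" 0 6] unfolding V by simp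
    moreover have "card (E4 \<union> pairs {0, 1, 4, 5}) + 1 \<le> 2 * 6"
      by (simp add: E4_def pairs_insert pairs_empty doubleton_eq_iff card_insert_if)
    ultimately show ?thesis using 3 by blast
  next
    case 4
    define m where "m = n - 3"
    have n: "n = m + 3" "4 \<le> m" using 4 by (auto simp: m_def)
    obtain E where E: "connected_cover_graph 4 1 m (Graph {..<m} E)" "card E + 1 \<le> 2 * m"
      using less.IH[of m] n by auto
    let ?K = "{0, m, m + 1, m + 2}"
    have V: "{..<m} \<union> ?K = {..<n}" using n by auto
    have "card ?K = 4" using n by simp
    then have "connected_cover_graph 4 1 n (Graph {..<n} (E \<union> pairs ?K))"
      using connected_cover_glue[OF E(1), of ?K 0 n] n unfolding V by simp
    moreover have "card (pairs ?K) \<le> 6"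
      using n by (simp add: pairs_insert pairs_empty doubleton_eq_iff card_insert_if)
    then have "card (E \<union> pairs ?K) + 1 \<le> 2 * n"
      using E(2) n card_Un_le[of E "pairs ?K"] by linarith
    ultimately show ?thesis by blast
  qed
qed

section \<open>Comparison of the two minima\<close>

theorem theorem3p4:
  fixes G :: "'a graph" and n :: nat
  assumes "n \<ge> 4"
    and "connected_cover_graph 3 2 n G"
    and "\<And>H :: 'a graph. connected_cover_graph 3 2 n H \<Longrightarrow> card (edges G) \<le> card (edges H)"
  shows "has_cover 4 1 G \<and> card (edges G) = F n"
proof -
  have G: "finite (verts G)" "card (verts G) = n"
    using assms(2) by (auto simp: connected_cover_graph_def fin_simple_graph_def)
  \<comment> \<open>Minimality of \<open>G\<close> concerns graphs on its own vertex type, so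
    \<open>H\<close> is first relabelled by the vertices of \<open>G\<close>, of which there are
    exactly \<open>n\<close>.\<close>
  have upper: "card (edges G) \<le> card (edges H)"
    if H: "connected_cover_graph 4 1 n H" for H :: "nat graph"
  proof -
    have "finite (verts H)" "card (verts H) = n"
      using H by (auto simp: connected_cover_graph_def fin_simple_graph_def)
    with G obtain f where f: "bij_betw f (verts H) (verts G)"
      by (metis finite_same_card_bij)
    have "connected_cover_graph 3 2 n H"
      using H has_cover_4_1_imp_3_2 by (auto simp: connected_cover_graph_def)
    from connected_cover_graph_image[OF this bij_betw_imp_inj_on[OF f]] assms(3)
    show ?thesis by metis
  qed
  obtain E where E: "connected_cover_graph 4 1 n (Graph {..<n} E)" "card E + 1 \<le> 2 * n"
    using sparse_4_1_cover_exists[OF assms(1)] by blast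
  have "card (edges G) + 1 \<le> 2 * n" using upper[OF E(1)] E(2) by simp
  then have cover: "has_cover 4 1 G" by (rule sparse_3_2_cover_imp_4_1_cover[OF assms(2)])
  then have G41: "connected_cover_graph 4 1 n G"
    using assms(2) by (simp add: connected_cover_graph_def)
  \<comment> \<open>Conversely, a copy of \<open>G\<close> on natural numbers shows that its edge
    count is attained in the definition of \<open>F\<close>.\<close>
  obtain f :: "'a \<Rightarrow> nat" where f: "inj_on f (verts G)"
    using G finite_imp_inj_to_nat_seg by metis
  have "F n = card (edges G)"
    unfolding F_def
  proof (rule Least_equality)
    show "\<exists>H :: nat graph. connected_cover_graph 4 1 n H \<and> card (edges H) = card (edges G)"
      using connected_cover_graph_image[OF G41 f] by blast
  qed (use upper in blast)
  with cover show ?thesis by simp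
qed

end
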